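(* Let $D$ be an almost Dedekind domain. Then the set $\mathcal{M}\setminus\mathrm{Crit}(D)$ of non-critical maximal ideals is dense in $\mathcal{M}$.
   Context: An almost Dedekind domain is an integral domain $D$ such that $D_M$ is a discrete valuation ring for every maximal ideal $M$ of $D$. A maximal ideal $M$ of $D$ is critical if $M$ does not contain any nonzero finitely generated radical ideal of $D$; $\mathrm{Crit}(D)$ is the set of critical maximal ideals. $\mathcal{M}$ denotes the set $\mathrm{Max}(D)$ endowed with the (subspace topology of the) constructible topology, i.e. the topology generated by the sets $\{M\in\mathrm{Max}(D)\mid I\subseteq M\}$ and $\{M\in\mathrm{Max}(D)\mid I\nsubseteq M\}$ as $I$ ranges among the finitely generated ideals of $D$. (On $\mathrm{Max}(D)$ this coincides with the inverse topology, generated by the sets $\{M\in\mathrm{Max}(D)\mid I\subseteq M\}$, $I$ finitely generated.) *)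

theory Defs
  imports "HOL-Analysis.Abstract_Topology" "HOL-Algebra.Ring_Divisibility"
begin

section \<open>Localization\<close>

text \<open>
  The fractions \<open>a/s\<close> and \<open>b/t\<close> with denominators in \<open>S\<close> are identified iff
  \<open>u(at - bs) = 0\<close> for some \<open>u \<in> S\<close>. Operations on classes are unions over representatives;
  by the lemmas below they are well defined when \<open>S\<close> is a submonoid of the multiplicative monoid.
\<close>

definition frac_rel :: "('a, 'b) ring_scheme \<Rightarrow> 'a set \<Rightarrow> (('a \<times> 'a) \<times> ('a \<times> 'a)) set" where
  "frac_rel R S = {((a, s), (b, t)). a \<in> carrier R \<and> b \<in> carrier R \<and> s \<in> S \<and> t \<in> S \<and>
     (\<exists>u\<in>S. u \<otimes>\<^bsub>R\<^esub> (a \<otimes>\<^bsub>R\<^esub> t \<ominus>\<^bsub>R\<^esub> b \<otimes>\<^bsub>R\<^esub> s) = \<zero>\<^bsub>R\<^esub>)}"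

definition loc_frac :: "('a, 'b) ring_scheme \<Rightarrow> 'a set \<Rightarrow> 'a \<Rightarrow> 'a \<Rightarrow> ('a \<times> 'a) set" where
  "loc_frac R S a s = frac_rel R S `` {(a, s)}"

definition localization :: "('a, 'b) ring_scheme \<Rightarrow> 'a set \<Rightarrow> ('a \<times> 'a) set ring" where
  "localization R S =
    \<lparr>carrier = (carrier R \<times> S) // frac_rel R S,
     monoid.mult = (\<lambda>X Y. \<Union>(a, s)\<in>X. \<Union>(b, t)\<in>Y. loc_frac R S (a \<otimes>\<^bsub>R\<^esub> b) (s \<otimes>\<^bsub>R\<^esub> t)),
     one = loc_frac R S \<one>\<^bsub>R\<^esub> \<one>\<^bsub>R\<^esub>,
     zero = loc_frac R S \<zero>\<^bsub>R\<^esub> \<one>\<^bsub>R\<^esub>,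
     add = (\<lambda>X Y. \<Union>(a, s)\<in>X. \<Union>(b, t)\<in>Y.
              loc_frac R S (a \<otimes>\<^bsub>R\<^esub> t \<oplus>\<^bsub>R\<^esub> b \<otimes>\<^bsub>R\<^esub> s) (s \<otimes>\<^bsub>R\<^esub> t))\<rparr>"

definition localization_at :: "('a, 'b) ring_scheme \<Rightarrow> 'a set \<Rightarrow> ('a \<times> 'a) set ring" where
  "localization_at R P = localization R (carrier R - P)"

lemma (in primeideal) submonoid_complement: "submonoid (carrier R - I) R"
proof
  show "x \<otimes> y \<in> carrier R - I" if "x \<in> carrier R - I" "y \<in> carrier R - I" for x y
    using that I_prime by blast
  show "\<one> \<in> carrier R - I"
    using I_notcarr one_imp_carrier by auto
qed auto

context cring
begin

lemma frac_rel_iff: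
  assumes "submonoid S R"
  shows "((a, s), (b, t)) \<in> frac_rel R S \<longleftrightarrow>
    a \<in> carrier R \<and> b \<in> carrier R \<and> s \<in> S \<and> t \<in> S \<and> (\<exists>u\<in>S. u \<otimes> (a \<otimes> t) = u \<otimes> (b \<otimes> s))"
proof -
  have S: "S \<subseteq> carrier R" using assms by (rule submonoid.subset)
  have "u \<otimes> (a \<otimes> t \<ominus> b \<otimes> s) = \<zero> \<longleftrightarrow> u \<otimes> (a \<otimes> t) = u \<otimes> (b \<otimes> s)"
    if "a \<in> carrier R" "b \<in> carrier R" "s \<in> S" "t \<in> S" "u \<in> S" for u
  proof -
    have c: "s \<in> carrier R" "t \<in> carrier R" "u \<in> carrier R" using that S by auto
    have "u \<otimes> (a \<otimes> t \<ominus> b \<otimes> s) = u \<otimes> (a \<otimes> t) \<ominus> u \<otimes> (b \<otimes> s)"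
      using that c by (simp add: a_minus_def r_distr r_minus)
    then show ?thesis using that c by simp
  qed
  then show ?thesis unfolding frac_rel_def by auto
qed

lemma equiv_frac_rel:
  assumes "submonoid S R"
  shows "equiv (carrier R \<times> S) (frac_rel R S)"
proof (rule equivI)
  interpret S: submonoid S R by (rule assms)
  note [simp] = frac_rel_iff[OF assms] S.mem_carrier
  show "frac_rel R S \<subseteq> (carrier R \<times> S) \<times> (carrier R \<times> S)"
    by (auto simp: frac_rel_def)
  show "refl_on (carrier R \<times> S) (frac_rel R S)"
    by (auto simp: refl_on_def intro: S.one_closed)
  show "sym (frac_rel R S)"
    by (rule symI) (auto simp del: S.mem_carrier, metis)
  show "trans (frac_rel R S)"
  proof (rule transI)
    fix x y z assume "(x, y) \<in> frac_rel R S" "(y, z) \<in> frac_rel R S"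
    moreover obtain a s b t c r where xyz: "x = (a, s)" "y = (b, t)" "z = (c, r)"
      by (metis surj_pair)
    ultimately obtain u v
      where A: "a \<in> carrier R" "b \<in> carrier R" "c \<in> carrier R" "s \<in> S" "t \<in> S" "r \<in> S" "u \<in> S" "v \<in> S"
        and e: "u \<otimes> (a \<otimes> t) = u \<otimes> (b \<otimes> s)" "v \<otimes> (b \<otimes> r) = v \<otimes> (c \<otimes> t)"
      by auto
    have "(u \<otimes> v \<otimes> t) \<otimes> (a \<otimes> r) = (u \<otimes> (a \<otimes> t)) \<otimes> (v \<otimes> r)"
      using A by (simp add: m_ac)
    also have "\<dots> = (v \<otimes> (b \<otimes> r)) \<otimes> (u \<otimes> s)"
      unfolding e(1) using A by (simp add: m_ac)
    also have "\<dots> = (u \<otimes> v \<otimes> t) \<otimes> (c \<otimes> s)"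
      unfolding e using A by (simp add: m_ac)
    finally show "(x, z) \<in> frac_rel R S"
      using A xyz by auto
  qed
qed

lemma loc_frac_eq_iff:
  assumes "submonoid S R" "a \<in> carrier R" "b \<in> carrier R" "s \<in> S" "t \<in> S"
  shows "loc_frac R S a s = loc_frac R S b t \<longleftrightarrow> (\<exists>u\<in>S. u \<otimes> (a \<otimes> t) = u \<otimes> (b \<otimes> s))"
  unfolding loc_frac_def
  using eq_equiv_class_iff[OF equiv_frac_rel[OF assms(1)], of "(a, s)" "(b, t)"]
    frac_rel_iff[OF assms(1)] assms by auto

lemma carrier_localization: "carrier (localization R S) = {loc_frac R S a s | a s. a \<in> carrier R \<and> s \<in> S}"
  by (auto simp: localization_def quotient_def loc_frac_def)

lemma mult_localization:
  assumes "submonoid S R" "a \<in> carrier R" "b \<in> carrier R" "s \<in> S" "t \<in> S"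
  shows "loc_frac R S a s \<otimes>\<^bsub>localization R S\<^esub> loc_frac R S b t = loc_frac R S (a \<otimes> b) (s \<otimes> t)"
proof -
  interpret S: submonoid S R by (rule assms)
  note [simp] = S.mem_carrier
  have *: "loc_frac R S (a' \<otimes> b') (s' \<otimes> t') = loc_frac R S (a \<otimes> b) (s \<otimes> t)"
    if h: "((a, s), (a', s')) \<in> frac_rel R S" "((b, t), (b', t')) \<in> frac_rel R S" for a' s' b' t'
  proof -
    obtain u v where A: "a' \<in> carrier R" "s' \<in> S" "b' \<in> carrier R" "t' \<in> S" "u \<in> S" "v \<in> S"
      and e: "u \<otimes> (a \<otimes> s') = u \<otimes> (a' \<otimes> s)" "v \<otimes> (b \<otimes> t') = v \<otimes> (b' \<otimes> t)"
      using h unfolding frac_rel_iff[OF assms(1)] by blast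
    have "(u \<otimes> v) \<otimes> ((a' \<otimes> b') \<otimes> (s \<otimes> t)) = (u \<otimes> (a' \<otimes> s)) \<otimes> (v \<otimes> (b' \<otimes> t))"
      using A assms by (simp add: m_ac)
    also have "\<dots> = (u \<otimes> v) \<otimes> ((a \<otimes> b) \<otimes> (s' \<otimes> t'))"
      unfolding e[symmetric] using A assms by (simp add: m_ac)
    finally show ?thesis
      using A assms by (subst loc_frac_eq_iff) auto
  qed
  have "(a, s) \<in> loc_frac R S a s" "(b, t) \<in> loc_frac R S b t"
    unfolding loc_frac_def using equiv_class_self[OF equiv_frac_rel[OF assms(1)]] assms by auto
  then have "(\<Union>p\<in>loc_frac R S a s. \<Union>q\<in>loc_frac R S b t. loc_frac R S (a \<otimes> b) (s \<otimes> t)) =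
      loc_frac R S (a \<otimes> b) (s \<otimes> t)"
    by auto
  moreover have "(\<Union>(a', s')\<in>loc_frac R S a s. \<Union>(b', t')\<in>loc_frac R S b t.
        loc_frac R S (a' \<otimes> b') (s' \<otimes> t')) =
      (\<Union>p\<in>loc_frac R S a s. \<Union>q\<in>loc_frac R S b t. loc_frac R S (a \<otimes> b) (s \<otimes> t))"
    unfolding split_def by (intro SUP_cong refl *) (simp_all add: loc_frac_def)
  ultimately show ?thesis
    unfolding localization_def by simp
qed

lemma add_localization:
  assumes "submonoid S R" "a \<in> carrier R" "b \<in> carrier R" "s \<in> S" "t \<in> S"
  shows "loc_frac R S a s \<oplus>\<^bsub>localization R S\<^esub> loc_frac R S b t = loc_frac R S (a \<otimes> t \<oplus> b \<otimes> s) (s \<otimes> t)"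
proof -
  interpret S: submonoid S R by (rule assms)
  note [simp] = S.mem_carrier
  have *: "loc_frac R S (a' \<otimes> t' \<oplus> b' \<otimes> s') (s' \<otimes> t') = loc_frac R S (a \<otimes> t \<oplus> b \<otimes> s) (s \<otimes> t)"
    if h: "((a, s), (a', s')) \<in> frac_rel R S" "((b, t), (b', t')) \<in> frac_rel R S" for a' s' b' t'
  proof -
    obtain u v where A: "a' \<in> carrier R" "s' \<in> S" "b' \<in> carrier R" "t' \<in> S" "u \<in> S" "v \<in> S"
      and e: "u \<otimes> (a \<otimes> s') = u \<otimes> (a' \<otimes> s)" "v \<otimes> (b \<otimes> t') = v \<otimes> (b' \<otimes> t)"
      using h unfolding frac_rel_iff[OF assms(1)] by blast
    have "(u \<otimes> v) \<otimes> ((a' \<otimes> t' \<oplus> b' \<otimes> s') \<otimes> (s \<otimes> t)) =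
        (u \<otimes> (a' \<otimes> s)) \<otimes> (v \<otimes> t \<otimes> t') \<oplus> (v \<otimes> (b' \<otimes> t)) \<otimes> (u \<otimes> s \<otimes> s')"
      using A assms by (simp add: m_ac r_distr l_distr)
    also have "\<dots> = (u \<otimes> v) \<otimes> ((a \<otimes> t \<oplus> b \<otimes> s) \<otimes> (s' \<otimes> t'))"
      unfolding e[symmetric] using A assms by (simp add: m_ac r_distr l_distr)
    finally show ?thesis
      using A assms by (subst loc_frac_eq_iff) auto
  qed
  have "(a, s) \<in> loc_frac R S a s" "(b, t) \<in> loc_frac R S b t"
    unfolding loc_frac_def using equiv_class_self[OF equiv_frac_rel[OF assms(1)]] assms by auto
  then have "(\<Union>p\<in>loc_frac R S a s. \<Union>q\<in>loc_frac R S b t. loc_frac R S (a \<otimes> t \<oplus> b \<otimes> s) (s \<otimes> t)) =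
      loc_frac R S (a \<otimes> t \<oplus> b \<otimes> s) (s \<otimes> t)"
    by auto
  moreover have "(\<Union>(a', s')\<in>loc_frac R S a s. \<Union>(b', t')\<in>loc_frac R S b t.
        loc_frac R S (a' \<otimes> t' \<oplus> b' \<otimes> s') (s' \<otimes> t')) =
      (\<Union>p\<in>loc_frac R S a s. \<Union>q\<in>loc_frac R S b t. loc_frac R S (a \<otimes> t \<oplus> b \<otimes> s) (s \<otimes> t))"
    unfolding split_def by (intro SUP_cong refl *) (simp_all add: loc_frac_def)
  ultimately show ?thesis
    unfolding localization_def by simp
qed

lemma cring_localization:
  assumes "submonoid S R"
  shows "cring (localization R S)"
proof -
  interpret S: submonoid S R by (rule assms)
  note [simp] = S.mem_carrier mult_localization[OF assms] add_localization[OF assms]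
  let ?L = "localization R S"
  have one: "\<one>\<^bsub>?L\<^esub> = loc_frac R S \<one> \<one>" and zero: "\<zero>\<^bsub>?L\<^esub> = loc_frac R S \<zero> \<one>"
    by (simp_all add: localization_def)
  have eqI: "loc_frac R S a s = loc_frac R S b t"
    if "a \<otimes> t = b \<otimes> s" "a \<in> carrier R" "b \<in> carrier R" "s \<in> S" "t \<in> S" for a b s t
    using that assms by (subst loc_frac_eq_iff) auto
  have fc: "loc_frac R S a s \<in> carrier ?L" if "a \<in> carrier R" "s \<in> S" for a s
    using that by (auto simp: carrier_localization)
  have E: thesis if "x \<in> carrier ?L" "\<And>a s. x = loc_frac R S a s \<Longrightarrow> a \<in> carrier R \<Longrightarrow> s \<in> S \<Longrightarrow> thesis"
    for x thesis using that by (auto simp: carrier_localization)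
  have neg: "\<exists>y\<in>carrier ?L. y \<oplus>\<^bsub>?L\<^esub> x = \<zero>\<^bsub>?L\<^esub>" if x: "x \<in> carrier ?L" for x
  proof -
    obtain a s where a: "x = loc_frac R S a s" "a \<in> carrier R" "s \<in> S" using x by (rule E)
    have "loc_frac R S (\<ominus> a) s \<oplus>\<^bsub>?L\<^esub> x = loc_frac R S \<zero> (s \<otimes> s)"
      using a by (simp add: l_minus l_neg)
    also have "\<dots> = \<zero>\<^bsub>?L\<^esub>"
      unfolding zero using a(3) by (intro eqI) auto
    finally have "loc_frac R S (\<ominus> a) s \<oplus>\<^bsub>?L\<^esub> x = \<zero>\<^bsub>?L\<^esub>" .
    moreover have "loc_frac R S (\<ominus> a) s \<in> carrier ?L" using fc a by simp
    ultimately show ?thesis by blast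
  qed
  show ?thesis
  proof (intro cringI abelian_groupI comm_monoidI)
    fix x y z
    assume "x \<in> carrier ?L" "y \<in> carrier ?L"
    then obtain a s b t
      where xy: "x = loc_frac R S a s" "a \<in> carrier R" "s \<in> S" "y = loc_frac R S b t" "b \<in> carrier R" "t \<in> S"
      by (metis E)
    show "x \<oplus>\<^bsub>?L\<^esub> y \<in> carrier ?L" "x \<otimes>\<^bsub>?L\<^esub> y \<in> carrier ?L"
      using xy fc by auto
    show "x \<oplus>\<^bsub>?L\<^esub> y = y \<oplus>\<^bsub>?L\<^esub> x" "x \<otimes>\<^bsub>?L\<^esub> y = y \<otimes>\<^bsub>?L\<^esub> x"
      using xy by (simp_all add: m_comm a_comm)
    assume "z \<in> carrier ?L"
    then obtain c r where z: "z = loc_frac R S c r" "c \<in> carrier R" "r \<in> S" by (metis E)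
    show "x \<oplus>\<^bsub>?L\<^esub> y \<oplus>\<^bsub>?L\<^esub> z = x \<oplus>\<^bsub>?L\<^esub> (y \<oplus>\<^bsub>?L\<^esub> z)"
      "x \<otimes>\<^bsub>?L\<^esub> y \<otimes>\<^bsub>?L\<^esub> z = x \<otimes>\<^bsub>?L\<^esub> (y \<otimes>\<^bsub>?L\<^esub> z)"
      using xy z by (simp_all add: m_ac a_ac l_distr r_distr)
    show "(x \<oplus>\<^bsub>?L\<^esub> y) \<otimes>\<^bsub>?L\<^esub> z = x \<otimes>\<^bsub>?L\<^esub> z \<oplus>\<^bsub>?L\<^esub> y \<otimes>\<^bsub>?L\<^esub> z"
      using xy z by (simp, intro eqI) (auto simp: m_ac a_ac l_distr r_distr)
  next
    fix x assume "x \<in> carrier ?L"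
    then obtain a s where a: "x = loc_frac R S a s" "a \<in> carrier R" "s \<in> S" by (metis E)
    show "\<zero>\<^bsub>?L\<^esub> \<oplus>\<^bsub>?L\<^esub> x = x" "\<one>\<^bsub>?L\<^esub> \<otimes>\<^bsub>?L\<^esub> x = x"
      unfolding zero one using a by simp_all
  next
    show "\<zero>\<^bsub>?L\<^esub> \<in> carrier ?L" "\<one>\<^bsub>?L\<^esub> \<in> carrier ?L"
      unfolding zero one by (simp_all add: fc)
  qed (rule neg)
qed

end

section \<open>Almost Dedekind domains and critical ideals\<close>

text \<open>A discrete valuation ring is by convention not a field; hence no field is almost Dedekind.\<close>

definition discrete_valuation_ring :: "('a, 'b) ring_scheme \<Rightarrow> bool" where
  "discrete_valuation_ring R \<longleftrightarrow> principal_domain R \<and> (\<exists>!M. maximalideal M R) \<and> \<not> field R"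

definition Max_spec :: "('a, 'b) ring_scheme \<Rightarrow> 'a set set" where
  "Max_spec R = {M. maximalideal M R}"

definition almost_dedekind_domain :: "('a, 'b) ring_scheme \<Rightarrow> bool" where
  "almost_dedekind_domain R \<longleftrightarrow>
     domain R \<and> (\<forall>M\<in>Max_spec R. discrete_valuation_ring (localization_at R M))"

definition fg_ideal :: "'a set \<Rightarrow> ('a, 'b) ring_scheme \<Rightarrow> bool" where
  "fg_ideal I R \<longleftrightarrow> (\<exists>A\<subseteq>carrier R. finite A \<and> I = Idl\<^bsub>R\<^esub> A)"

definition radical :: "('a, 'b) ring_scheme \<Rightarrow> 'a set \<Rightarrow> 'a set" where
  "radical R I = {x \<in> carrier R. \<exists>n>0::nat. x [^]\<^bsub>R\<^esub> n \<in> I}"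

definition radical_ideal :: "'a set \<Rightarrow> ('a, 'b) ring_scheme \<Rightarrow> bool" where
  "radical_ideal I R \<longleftrightarrow> ideal I R \<and> radical R I = I"

definition Crit :: "('a, 'b) ring_scheme \<Rightarrow> 'a set set" where
  "Crit R = {M \<in> Max_spec R.
     \<not> (\<exists>I. fg_ideal I R \<and> radical_ideal I R \<and> I \<noteq> {\<zero>\<^bsub>R\<^esub>} \<and> I \<subseteq> M)}"

definition constructible_Max :: "('a, 'b) ring_scheme \<Rightarrow> 'a set topology" where
  "constructible_Max R = topology_generated_by
     ({{M \<in> Max_spec R. I \<subseteq> M} | I. fg_ideal I R} \<union> {{M \<in> Max_spec R. \<not> I \<subseteq> M} | I. fg_ideal I R})"

lemma topspace_constructible_Max [simp]: "topspace (constructible_Max R) = Max_spec R"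
proof -
  have "fg_ideal (Idl\<^bsub>R\<^esub> {}) R" unfolding fg_ideal_def by blast
  then have "M \<in> topspace (constructible_Max R)" if "M \<in> Max_spec R" for M
    unfolding constructible_Max_def topology_generated_by_topspace
    using that by (cases "Idl\<^bsub>R\<^esub> {} \<subseteq> M") auto
  moreover have "topspace (constructible_Max R) \<subseteq> Max_spec R"
    unfolding constructible_Max_def topology_generated_by_topspace by auto
  ultimately show ?thesis by auto
qed

end

theory Submission
  imports Defs
begin

text \<open>
  Write \<open>v\<^sub>M\<close> for the valuation of \<open>D\<^sub>M\<close> and \<open>V(A)\<close> for the set of maximal ideals containing \<open>A\<close>.
  The sets \<open>V(A)\<close>, with \<open>A\<close> finite, form a basis of the topology. Fix \<open>0 \<noteq> a \<in> A\<close> with \<open>V(A)\<close>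
  nonempty. If \<open>s a = c t\<^sup>n\<close> with \<open>s \<notin> M\<close> and \<open>t \<in> M\<close>, then the same equation shows
  \<open>v\<^sub>N(a) \<ge> n\<close> for all \<open>N\<close> in a neighbourhood of \<open>M\<close>. Hence, if \<open>v(a)\<close> were unbounded on \<open>V(B)\<close>
  for every finite \<open>B \<supseteq> A\<close> with \<open>V(B)\<close> nonempty, there would be an increasing sequence of such \<open>B\<close>
  whose union lies in a maximal ideal \<open>N\<close> with \<open>v\<^sub>N(a) = \<infinity>\<close>, a contradiction (this is the
  Baire category argument on the compact space \<open>V(A)\<close>). So \<open>v(a)\<close> is bounded on some \<open>V(B)\<close>. Let
  it attain its maximum \<open>k\<close> there at \<open>M\<close>, and write \<open>s a = u t\<^sup>k\<close> with \<open>t\<close> a uniformizer at \<open>M\<close>.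
  Then \<open>k \<ge> k v\<^sub>N(t)\<close>, that is, \<open>v\<^sub>N(t) = 1\<close>, for all \<open>N \<in> V(B \<union> {t})\<close> near \<open>M\<close>. Thus \<open>B\<close>, \<open>t\<close>
  and one further element cutting out that neighbourhood generate an ideal that is locally equal to \<open>N\<close>
  at each \<open>N\<close> containing it, hence a radical ideal contained in \<open>M\<close>.
\<close>

section \<open>Maximal ideals\<close>

context cring
begin

lemma ideal_subset_maximalideal:
  assumes "ideal I R" "\<one> \<notin> I"
  obtains M where "maximalideal M R" "I \<subseteq> M"
proof -
  let ?S = "{J. ideal J R \<and> I \<subseteq> J \<and> \<one> \<notin> J}"
  have "\<exists>M\<in>?S. \<forall>J\<in>?S. M \<subseteq> J \<longrightarrow> J = M"
  proof (rule subset_Zorn)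
    fix C assume C: "subset.chain ?S C"
    show "\<exists>U\<in>?S. \<forall>J\<in>C. J \<subseteq> U"
    proof (cases "C = {}")
      case True
      then show ?thesis using assms by auto
    next
      case False
      have "subset.chain {J. ideal J R} C"
        using C unfolding pred_on.chain_def by auto
      then have "ideal (\<Union>C) R"
        using chain_Union_is_ideal[of C] False by simp
      moreover have "I \<subseteq> \<Union>C" "\<one> \<notin> \<Union>C"
        using C False unfolding pred_on.chain_def by blast+
      ultimately show ?thesis by blast
    qed
  qed
  then obtain M where "M \<in> ?S" and max: "\<forall>J\<in>?S. M \<subseteq> J \<longrightarrow> J = M" ..
  then have M: "ideal M R" "I \<subseteq> M" "\<one> \<notin> M" by simp_all
  have "maximalideal M R"
  proof (rule maximalidealI[OF M(1)])
    show "carrier R \<noteq> M" using M(3) by auto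
    fix J assume J: "ideal J R" "M \<subseteq> J" "J \<subseteq> carrier R"
    show "J = M \<or> J = carrier R"
    proof (cases "\<one> \<in> J")
      case True
      then show ?thesis using ideal.one_imp_carrier J(1) by blast
    next
      case False
      then have "J \<in> ?S" using J M(2) by auto
      then show ?thesis using max J(2) by blast
    qed
  qed
  then show thesis using that M(2) by blast
qed

text \<open>Turns "\<open>s\<close> lies outside the maximal ideal" into membership of another
  element: any maximal ideal containing \<open>g\<close> omits \<open>s\<close>, by
  \<open>comaximal_not_mem\<close>. Neighbourhoods can therefore be cut out by containment
  conditions alone.\<close>

lemma maximalideal_comaximal:
  assumes "maximalideal M R" "s \<in> carrier R" "s \<notin> M"
  obtains g h where "g \<in> M" "h \<in> carrier R" "s \<otimes> h \<oplus> g = \<one>"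
proof -
  interpret M: maximalideal M R by fact
  have Ps: "ideal (PIdl s) R" "s \<in> PIdl s"
    using assms cgenideal_ideal cgenideal_self by auto
  have sum: "ideal (PIdl s <+>\<^bsub>R\<^esub> M) R"
    using add_ideals Ps M.is_ideal by blast
  have sumI: "x \<oplus> y \<in> PIdl s <+>\<^bsub>R\<^esub> M" if "x \<in> PIdl s" "y \<in> M" for x y
    using that unfolding set_add_def' by blast
  have "M \<subseteq> PIdl s <+>\<^bsub>R\<^esub> M"
    using sumI[OF additive_subgroup.zero_closed[OF ideal.axioms(1)[OF Ps(1)]]] M.Icarr by fastforce
  moreover have "s \<in> PIdl s <+>\<^bsub>R\<^esub> M"
    using sumI[OF Ps(2) M.zero_closed] assms(2) by simp
  ultimately have "PIdl s <+>\<^bsub>R\<^esub> M = carrier R"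
    using M.I_maximal[OF sum] ideal.Icarr[OF sum] assms(3) by blast
  then have "\<one> \<in> PIdl s <+>\<^bsub>R\<^esub> M" by simp
  then obtain h g where "h \<in> carrier R" "g \<in> M" "\<one> = h \<otimes> s \<oplus> g"
    unfolding set_add_def' cgenideal_def by auto
  then show thesis
    using that[of g h] assms(2) by (simp add: m_comm)
qed

lemma comaximal_not_mem:
  assumes "maximalideal N R" "g \<in> N" "h \<in> carrier R" "s \<otimes> h \<oplus> g = \<one>"
  shows "s \<notin> N"
proof
  interpret N: maximalideal N R by fact
  assume "s \<in> N"
  then have "\<one> \<in> N"
    using assms N.I_r_closed N.a_closed by metis
  then show False
    using N.one_imp_carrier N.I_notcarr by blast
qed

lemma (in primeideal) pow_mem:
  assumes "x \<in> carrier R" "x [^] (n::nat) \<in> I"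
  shows "x \<in> I"
  using assms(2)
proof (induction n)
  case 0
  then show ?case using one_imp_carrier I_notcarr by auto
next
  case (Suc n)
  then show ?case using I_prime[of "x [^] n" x] assms(1) by auto
qed

text \<open>The colon ideal \<open>(I : x)\<close>, on which the local membership test
  rests.\<close>

lemma ideal_quotient:
  assumes "ideal I R" "x \<in> carrier R"
  shows "ideal {r \<in> carrier R. r \<otimes> x \<in> I} R"
proof -
  interpret I: ideal I R by fact
  show ?thesis
  proof (rule idealI[OF ring_axioms])
    show "subgroup {r \<in> carrier R. r \<otimes> x \<in> I} (add_monoid R)"
      using assms(2) I.a_inv_closed
      by unfold_locales (auto simp: l_distr l_minus a_inv_def[symmetric])
    show "y \<otimes> r \<in> {r \<in> carrier R. r \<otimes> x \<in> I}" "r \<otimes> y \<in> {r \<in> carrier R. r \<otimes> x \<in> I}"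
      if "r \<in> {r \<in> carrier R. r \<otimes> x \<in> I}" "y \<in> carrier R" for r y
    proof -
      have "y \<otimes> r \<otimes> x = y \<otimes> (r \<otimes> x)" using that assms(2) by (simp add: m_assoc)
      then show "y \<otimes> r \<in> {r \<in> carrier R. r \<otimes> x \<in> I}"
        using that I.I_l_closed by auto
      then show "r \<otimes> y \<in> {r \<in> carrier R. r \<otimes> x \<in> I}"
        using that by (simp add: m_comm)
    qed
  qed
qed

text \<open>If \<open>x\<close> were outside \<open>I\<close>, the colon ideal
  \<open>(I : x)\<close> would be proper, hence inside a maximal ideal \<open>N\<close>. As
  \<open>N\<close> also contains \<open>I\<close>, the hypothesis gives an element of
  \<open>(I : x)\<close> outside \<open>N\<close>.\<close>

lemma mem_ideal_if_locally:
  assumes "ideal I R" "x \<in> carrier R"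
    and "\<And>N. maximalideal N R \<Longrightarrow> I \<subseteq> N \<Longrightarrow> \<exists>r\<in>carrier R - N. r \<otimes> x \<in> I"
  shows "x \<in> I"
proof (rule ccontr)
  let ?Q = "{r \<in> carrier R. r \<otimes> x \<in> I}"
  assume "x \<notin> I"
  then have "\<one> \<notin> ?Q" using assms(2) by simp
  then obtain N where N: "maximalideal N R" "?Q \<subseteq> N"
    using ideal_subset_maximalideal ideal_quotient[OF assms(1,2)] by metis
  have "I \<subseteq> ?Q"
    using assms(1,2) ideal.Icarr[OF assms(1)] ideal.I_r_closed[OF assms(1)] by auto
  then show False
    using assms(3) N by blast
qed

lemma constructible_Max_basis:
  assumes "openin (constructible_Max R) U" "M \<in> U"
  obtains A where "finite A" "A \<subseteq> M" "\<And>N. maximalideal N R \<Longrightarrow> A \<subseteq> N \<Longrightarrow> N \<in> U"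
proof -
  have "\<exists>A. finite A \<and> A \<subseteq> M \<and> (\<forall>N. maximalideal N R \<longrightarrow> A \<subseteq> N \<longrightarrow> N \<in> U)"
    using openin_topology_generated_by[OF assms(1)[unfolded constructible_Max_def]] assms(2)
  proof (induction rule: generate_topology_on.induct)
    case Empty
    then show ?case by simp
  next
    case (Int a b)
    obtain A where A: "finite A" "A \<subseteq> M" "\<forall>N. maximalideal N R \<longrightarrow> A \<subseteq> N \<longrightarrow> N \<in> a"
      using Int by blast
    obtain B where B: "finite B" "B \<subseteq> M" "\<forall>N. maximalideal N R \<longrightarrow> B \<subseteq> N \<longrightarrow> N \<in> b"
      using Int by blast
    show ?case using A B by (intro exI[of _ "A \<union> B"]) auto
  next
    case (UN K)
    then obtain k where k: "k \<in> K" "M \<in> k" by blast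
    then show ?case using UN.IH[OF k] by blast
  next
    case (Basis S)
    then obtain I where I: "fg_ideal I R" and S: "S = {M \<in> Max_spec R. I \<subseteq> M} \<or> S = {M \<in> Max_spec R. \<not> I \<subseteq> M}"
      by blast
    then obtain A where A: "A \<subseteq> carrier R" "finite A" "I = Idl A"
      unfolding fg_ideal_def by blast
    have M: "maximalideal M R" using S Basis unfolding Max_spec_def by blast
    have sub: "I \<subseteq> N \<longleftrightarrow> A \<subseteq> N" if "maximalideal N R" for N
      using A genideal_self genideal_minimal maximalideal.axioms(1)[OF that] by blast
    from S show ?case
    proof
      assume S: "S = {M \<in> Max_spec R. I \<subseteq> M}"
      then show ?thesis
        using A sub M Basis unfolding Max_spec_def by (intro exI[of _ A]) auto
    next
      \<comment> \<open>Some generator \<open>s\<close> of \<open>I\<close> avoids \<open>M\<close>;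
        a comaximal \<open>g\<close> in \<open>M\<close> replaces this negative condition by the
        positive one that \<open>g\<close> lies in \<open>N\<close>.\<close>
      assume S: "S = {M \<in> Max_spec R. \<not> I \<subseteq> M}"
      then obtain s where s: "s \<in> A" "s \<notin> M"
        using sub[OF M] Basis by blast
      then obtain g h where g: "g \<in> M" "h \<in> carrier R" "s \<otimes> h \<oplus> g = \<one>"
        using maximalideal_comaximal[OF M] A by blast
      have "\<not> A \<subseteq> N" if "maximalideal N R" "g \<in> N" for N
        using comaximal_not_mem[OF that g(2,3)] s by blast
      then show ?thesis
        using g(1) sub S unfolding Max_spec_def by (intro exI[of _ "{g}"]) auto
    qed
  qed
  then show thesis using that by blast
qed

end

section \<open>Uniformizers\<close>

text \<open>Every irreducible generates a maximal ideal, so \<open>p\<close> is the only irreducible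
  up to units, and a factorization into irreducibles collapses to a power of
  \<open>p\<close>.\<close>

lemma (in principal_domain) unit_times_power_if_unique_maximalideal:
  assumes "\<And>M N. maximalideal M R \<Longrightarrow> maximalideal N R \<Longrightarrow> M = N"
    and p: "p \<in> carrier R" "maximalideal (PIdl p) R"
    and x: "x \<in> carrier R" "x \<noteq> \<zero>"
  shows "\<exists>n::nat. \<exists>u\<in>Units R. x = u \<otimes> p [^] n"
proof (cases "x \<in> Units R")
  case True
  then have "x = x \<otimes> p [^] (0::nat)" using x by simp
  then show ?thesis using True by blast
next
  case False
  have irr: "\<exists>u\<in>Units R. q = u \<otimes> p" if "q \<in> carrier R" "ring_irreducible q" for q
  proof -
    have "PIdl q = PIdl p"
      using assms(1)[OF irreducible_imp_maximalideal[OF that] p(2)] .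
    then have "q \<sim> p"
      using associated_iff_same_ideal that p by simp
    then show ?thesis
      using that p ring_associated_iff by blast
  qed
  have prod: "\<exists>n::nat. \<exists>u\<in>Units R. foldr (\<otimes>) fs \<one> = u \<otimes> p [^] n"
    if "set fs \<subseteq> carrier R" "\<forall>f\<in>set fs. ring_irreducible f" for fs
    using that
  proof (induction fs)
    case Nil
    have "\<one> = \<one> \<otimes> p [^] (0::nat)" by simp
    then show ?case using Units_one_closed by (metis foldr_Nil id_apply)
  next
    case (Cons f fs)
    then obtain n :: nat and u where u: "u \<in> Units R" "foldr (\<otimes>) fs \<one> = u \<otimes> p [^] n"
      by auto
    obtain v where v: "v \<in> Units R" "f = v \<otimes> p"
      using irr[of f] Cons.prems by auto
    have "foldr (\<otimes>) (f # fs) \<one> = (v \<otimes> p) \<otimes> (u \<otimes> p [^] n)"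
      using u(2) v(2) by simp
    also have "\<dots> = (v \<otimes> u) \<otimes> p [^] Suc n"
      using u(1) v(1) p(1) by (simp add: m_ac Units_closed)
    finally show ?case using u(1) v(1) Units_m_closed by blast
  qed
  \<comment> \<open>The factorization lives in the monoid \<open>mult_of R\<close> of nonzero
    elements; its irreducible factors are transferred back to the ring afterwards.\<close>
  obtain fs where fs: "set fs \<subseteq> carrier (mult_of R)" "wfactors (mult_of R) fs x"
    using factorization_property[of x] x False by auto
  have "\<forall>f\<in>set fs. ring_irreducible f"
    using fs ring_irreducibleI' unfolding wfactors_def by auto
  moreover have "set fs \<subseteq> carrier R" using fs(1) by auto
  ultimately obtain n :: nat and u where u: "u \<in> Units R" "foldr (\<otimes>) fs \<one> = u \<otimes> p [^] n"
    using prod by blast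
  have "u \<otimes> p [^] n \<sim> x"
    using fs(2) u(2) Units_closed[OF u(1)] p(1) x assoc_iff_assoc_mult unfolding wfactors_def by simp
  then have "x \<sim> u \<otimes> p [^] n" by (rule associated_sym)
  then obtain w where w: "w \<in> Units R" "x = w \<otimes> (u \<otimes> p [^] n)"
    using ring_associated_iff[of x "u \<otimes> p [^] n"] Units_closed[OF u(1)] p(1) x by auto
  then have "x = (w \<otimes> u) \<otimes> p [^] n"
    using u p by (simp add: m_assoc Units_closed)
  then show ?thesis using u w Units_m_closed by blast
qed

lemma (in cring) loc_frac_pow:
  assumes "submonoid S R" "a \<in> carrier R" "s \<in> S"
  shows "loc_frac R S a s [^]\<^bsub>localization R S\<^esub> (n::nat) = loc_frac R S (a [^] n) (s [^] n) \<and> s [^] n \<in> S"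
proof (induction n)
  interpret L: cring "localization R S"
    using cring_localization[OF assms(1)] .
  {
    case 0
    then show ?case using submonoid.one_closed[OF assms(1)] by (simp add: localization_def)
  next
    case (Suc n)
    then show ?case
      using assms mult_localization[OF assms(1)] submonoid.m_closed[OF assms(1)] by simp
  }
qed

text \<open>With denominators cleared, this says that in the localization at \<open>M\<close> every
  nonzero \<open>x\<close> is a unit times a power of \<open>t\<close>; the exponent is
  \<open>v_M(x)\<close>. All later arguments can then stay inside \<open>R\<close>.\<close>

definition uniformizer_at :: "('a, 'b) ring_scheme \<Rightarrow> 'a set \<Rightarrow> 'a \<Rightarrow> bool" where
  "uniformizer_at R M t \<longleftrightarrow> t \<in> M \<and> t \<noteq> \<zero>\<^bsub>R\<^esub> \<and>
    (\<forall>x\<in>carrier R - {\<zero>\<^bsub>R\<^esub>}. \<exists>n::nat. \<exists>s\<in>carrier R - M. \<exists>u\<in>carrier R - M.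
      s \<otimes>\<^bsub>R\<^esub> x = u \<otimes>\<^bsub>R\<^esub> t [^]\<^bsub>R\<^esub> n)"

context domain
begin

text \<open>Take for \<open>t\<close> the numerator of a generator \<open>p\<close> of the maximal
  ideal of the localization.\<close>

lemma uniformizer_at_exists:
  assumes M: "maximalideal M R" and dvr: "discrete_valuation_ring (localization_at R M)"
  obtains t where "uniformizer_at R M t"
proof -
  define S where "S = carrier R - M"
  define L where "L = localization R S"
  interpret M: primeideal M R
    using maximalideal_prime[OF M] .
  have S: "submonoid S R"
    unfolding S_def by (rule M.submonoid_complement)
  have one: "\<one> \<in> S" using submonoid.one_closed[OF S] .
  have one_L: "\<one>\<^bsub>L\<^esub> = loc_frac R S \<one> \<one>" and zero_L: "\<zero>\<^bsub>L\<^esub> = loc_frac R S \<zero> \<one>"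
    by (simp_all add: L_def localization_def)
  have dvr: "principal_domain L" "\<exists>!M. maximalideal M L" "\<not> field L"
    using dvr unfolding discrete_valuation_ring_def localization_at_def S_def L_def by auto
  interpret L: principal_domain L by (rule dvr)
  obtain P where P: "maximalideal P L" using dvr(2) by blast
  then obtain p where p: "p \<in> carrier L" "P = PIdl\<^bsub>L\<^esub> p"
    using L.exists_gen maximalideal.axioms(1) by blast
  \<comment> \<open>Otherwise the zero ideal would be maximal and \<open>L\<close> a field, which
    the convention on discrete valuation rings excludes.\<close>
  have "p \<noteq> \<zero>\<^bsub>L\<^esub>"
    using dvr(3) P p L.zeromaximalideal_fieldI
    by (metis L.cgenideal_eq_genideal L.genideal_zero)
  obtain t s where ts: "p = loc_frac R S t s" "t \<in> carrier R" "s \<in> S"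
    using p(1) unfolding L_def carrier_localization by blast
  have s: "s \<in> carrier R" using ts(3) by (simp add: S_def)
  have "t \<in> M"
  proof (rule ccontr)
    assume "t \<notin> M"
    then have "t \<in> S" using ts by (simp add: S_def)
    then have "p \<otimes>\<^bsub>L\<^esub> loc_frac R S s t = \<one>\<^bsub>L\<^esub>"
      unfolding one_L unfolding L_def ts(1) using ts s S one submonoid.m_closed[OF S]
      by (auto simp: mult_localization loc_frac_eq_iff m_comm)
    moreover have "loc_frac R S s t \<in> carrier L"
      using s \<open>t \<in> S\<close> unfolding L_def carrier_localization by blast
    ultimately have "p \<in> Units L"
      using p(1) L.m_comm unfolding Units_def by force
    then show False
      using L.ideal_eq_carrier_iff[OF p(1)] P p(2) maximalideal.I_notcarr by blast
  qed
  moreover have "t \<noteq> \<zero>"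
  proof
    assume "t = \<zero>"
    then have "p = \<zero>\<^bsub>L\<^esub>"
      unfolding zero_L ts(1) using ts s S one by (auto simp: loc_frac_eq_iff)
    with \<open>p \<noteq> \<zero>\<^bsub>L\<^esub>\<close> show False by blast
  qed
  moreover have "\<exists>n::nat. \<exists>s\<in>carrier R - M. \<exists>u\<in>carrier R - M. s \<otimes> x = u \<otimes> t [^] n"
    if x: "x \<in> carrier R - {\<zero>}" for x
  proof -
    have x1: "loc_frac R S x \<one> \<in> carrier L"
      using x one unfolding L_def carrier_localization by blast
    have "loc_frac R S x \<one> \<noteq> \<zero>\<^bsub>L\<^esub>"
    proof
      assume "loc_frac R S x \<one> = \<zero>\<^bsub>L\<^esub>"
      then obtain y where "y \<in> S" "y \<otimes> (x \<otimes> \<one>) = y \<otimes> (\<zero> \<otimes> \<one>)"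
        unfolding zero_L using loc_frac_eq_iff[OF S] x one by auto
      then have "y = \<zero>"
        using x integral_iff unfolding S_def by auto
      then show False using \<open>y \<in> S\<close> M.zero_closed by (simp add: S_def)
    qed
    then obtain n :: nat and U where U: "U \<in> Units L" "loc_frac R S x \<one> = U \<otimes>\<^bsub>L\<^esub> p [^]\<^bsub>L\<^esub> n"
      using L.unit_times_power_if_unique_maximalideal[OF _ p(1) _ x1] dvr(2) P p(2) by blast
    obtain u w where uw: "U = loc_frac R S u w" "u \<in> carrier R" "w \<in> S"
      using U(1) L.Units_closed unfolding L_def carrier_localization by blast
    have w: "w \<in> carrier R" using uw by (simp add: S_def)
    \<comment> \<open>An inverse \<open>v/r\<close> of \<open>u/w\<close> gives
      \<open>z u v = z w r\<close> for some \<open>z\<close> outside \<open>M\<close>. The right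
      side is outside \<open>M\<close>, so \<open>u\<close> cannot be in \<open>M\<close>.\<close>
    have "u \<notin> M"
    proof
      assume "u \<in> M"
      obtain V where V: "V \<in> carrier L" "U \<otimes>\<^bsub>L\<^esub> V = \<one>\<^bsub>L\<^esub>"
        using U(1) unfolding Units_def by blast
      then obtain v r where vr: "V = loc_frac R S v r" "v \<in> carrier R" "r \<in> S"
        unfolding L_def carrier_localization by blast
      have "loc_frac R S (u \<otimes> v) (w \<otimes> r) = loc_frac R S \<one> \<one>"
        using V(2) mult_localization[OF S] uw vr unfolding one_L unfolding L_def by simp
      moreover have wr: "w \<otimes> r \<in> S" using uw vr submonoid.m_closed[OF S] by blast
      ultimately obtain z where z: "z \<in> S" "z \<otimes> (u \<otimes> v \<otimes> \<one>) = z \<otimes> (\<one> \<otimes> (w \<otimes> r))"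
        using loc_frac_eq_iff[OF S] uw vr one by auto
      have "z \<in> carrier R" using z by (simp add: S_def)
      then have "z \<otimes> (u \<otimes> v \<otimes> \<one>) \<in> M"
        using \<open>u \<in> M\<close> vr by (intro M.I_l_closed M.I_r_closed one_closed)
      moreover have "z \<otimes> (\<one> \<otimes> (w \<otimes> r)) \<in> S"
        using z wr submonoid.m_closed[OF S] by (simp add: S_def)
      ultimately show False using z(2) by (simp add: S_def)
    qed
    have sn: "s [^] n \<in> S" and pn: "p [^]\<^bsub>L\<^esub> n = loc_frac R S (t [^] n) (s [^] n)"
      using loc_frac_pow[OF S ts(2,3)] unfolding ts(1) L_def by auto
    have wsn: "w \<otimes> s [^] n \<in> S" using uw sn submonoid.m_closed[OF S] by blast
    have "loc_frac R S x \<one> = loc_frac R S (u \<otimes> t [^] n) (w \<otimes> s [^] n)"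
      using U(2) pn mult_localization[OF S] uw sn ts unfolding L_def by simp
    then obtain y where y: "y \<in> S" "y \<otimes> (x \<otimes> (w \<otimes> s [^] n)) = y \<otimes> (u \<otimes> t [^] n \<otimes> \<one>)"
      using loc_frac_eq_iff[OF S] x one wsn uw ts by auto
    have yc: "y \<in> carrier R" using y by (simp add: S_def)
    have "(y \<otimes> (w \<otimes> s [^] n)) \<otimes> x = y \<otimes> (x \<otimes> (w \<otimes> s [^] n))"
      using x w s yc by (simp add: m_ac)
    also have "\<dots> = (y \<otimes> u) \<otimes> t [^] n"
      unfolding y(2) using uw ts yc by (simp add: m_assoc)
    finally have "(y \<otimes> (w \<otimes> s [^] n)) \<otimes> x = (y \<otimes> u) \<otimes> t [^] n" .
    moreover have "y \<otimes> (w \<otimes> s [^] n) \<in> carrier R - M" "y \<otimes> u \<in> carrier R - M"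
      using submonoid.m_closed[OF S] y(1) wsn uw(2) \<open>u \<notin> M\<close> unfolding S_def by blast+
    ultimately show ?thesis by blast
  qed
  ultimately show thesis
    using that unfolding uniformizer_at_def by blast
qed

end

section \<open>The order at a maximal ideal\<close>

text \<open>
  Expresses \<open>v\<^sub>M(x) \<ge> n\<close>; quantifying over all \<open>t \<in> M\<close> instead of fixing a uniformizer allows
  the same witnesses to be used at other maximal ideals.
\<close>

definition order_ge :: "('a, 'b) ring_scheme \<Rightarrow> 'a set \<Rightarrow> nat \<Rightarrow> 'a \<Rightarrow> bool" where
  "order_ge R M n x \<longleftrightarrow> (\<exists>s\<in>carrier R - M. \<exists>t\<in>M. \<exists>c\<in>carrier R.
     s \<otimes>\<^bsub>R\<^esub> x = c \<otimes>\<^bsub>R\<^esub> t [^]\<^bsub>R\<^esub> n)"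

context cring
begin

lemma order_ge_mono:
  assumes "maximalideal M R" "order_ge R M n x" "m \<le> n"
  shows "order_ge R M m x"
proof -
  interpret M: maximalideal M R by fact
  obtain s t c where w: "s \<in> carrier R - M" "t \<in> M" "c \<in> carrier R" "s \<otimes> x = c \<otimes> t [^] n"
    using assms(2) unfolding order_ge_def by blast
  have "t \<in> carrier R" using w M.Icarr by blast
  moreover have "t [^] n = t [^] (n - m) \<otimes> t [^] m"
    using \<open>t \<in> carrier R\<close> assms(3) by (simp add: nat_pow_mult)
  ultimately have "s \<otimes> x = (c \<otimes> t [^] (n - m)) \<otimes> t [^] m"
    using w by (simp add: m_assoc)
  then show ?thesis
    unfolding order_ge_def using w \<open>t \<in> carrier R\<close> by blast
qed

text \<open>The witnessing equation does not mention \<open>M\<close>. It serves at every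
  \<open>N\<close> that contains \<open>t\<close> and omits \<open>s\<close>, which is ensured by
  adding \<open>t\<close> and a \<open>g\<close> comaximal with \<open>s\<close> to
  \<open>A\<close>.\<close>

lemma order_ge_locally:
  assumes "maximalideal M R" "A \<subseteq> M" "finite A" "order_ge R M n a"
  obtains B where "finite B" "A \<subseteq> B" "B \<subseteq> M"
    "\<And>N. maximalideal N R \<Longrightarrow> B \<subseteq> N \<Longrightarrow> order_ge R N n a"
proof -
  obtain s t c where w: "s \<in> carrier R - M" "t \<in> M" "c \<in> carrier R" "s \<otimes> a = c \<otimes> t [^] n"
    using assms(4) unfolding order_ge_def by blast
  obtain g h where g: "g \<in> M" "h \<in> carrier R" "s \<otimes> h \<oplus> g = \<one>"
    using maximalideal_comaximal[OF assms(1)] w(1) by blast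
  show thesis
  proof (rule that[of "insert g (insert t A)"])
    fix N assume N: "maximalideal N R" "insert g (insert t A) \<subseteq> N"
    then have "s \<notin> N" using comaximal_not_mem g by blast
    then show "order_ge R N n a" using w N unfolding order_ge_def by blast
  qed (use assms g w in auto)
qed

end

context domain
begin

text \<open>The exponent is positive, since exponent 0 would give \<open>s x = u\<close> with the
  left side in \<open>M\<close> and the right side outside.\<close>

lemma uniformizer_at_factor_mem:
  assumes M: "maximalideal M R" and t: "uniformizer_at R M t" and x: "x \<in> M" "x \<noteq> \<zero>"
  obtains j s u where "s \<in> carrier R - M" "u \<in> carrier R - M" "s \<otimes> x = u \<otimes> t [^] Suc j"
proof -
  interpret M: maximalideal M R by fact
  obtain n :: nat and s u where w: "s \<in> carrier R - M" "u \<in> carrier R - M" "s \<otimes> x = u \<otimes> t [^] n"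
    using t x M.Icarr unfolding uniformizer_at_def by blast
  have "s \<otimes> x \<in> M" using w x M.I_l_closed by blast
  then have "n \<noteq> 0" using w by (intro notI) simp
  then show thesis using that w not0_implies_Suc by blast
qed

text \<open>If the order were at least \<open>k + 1\<close>, comparing the two equations for
  \<open>a\<close> and cancelling \<open>t [^] k\<close> would put a product of elements outside
  \<open>M\<close> into the prime ideal \<open>M\<close>.\<close>

lemma order_ge_le:
  assumes M: "maximalideal M R" and t: "uniformizer_at R M t"
    and e: "s \<in> carrier R - M" "u \<in> carrier R - M" "a \<in> carrier R" "a \<noteq> \<zero>"
      "s \<otimes> a = u \<otimes> t [^] k"
    and ge: "order_ge R M n a"
  shows "n \<le> k"
proof (rule ccontr)
  assume "\<not> n \<le> k"
  then have "Suc k \<le> n" by simp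
  then have "order_ge R M (Suc k) a" using order_ge_mono[OF M ge] by blast
  then obtain r b c where w: "r \<in> carrier R - M" "b \<in> M" "c \<in> carrier R"
    "r \<otimes> a = c \<otimes> b [^] Suc k"
    unfolding order_ge_def by blast
  interpret M: primeideal M R using maximalideal_prime[OF M] .
  have tM: "t \<in> M" "t \<noteq> \<zero>" using t unfolding uniformizer_at_def by auto
  have "b \<noteq> \<zero>"
  proof
    assume "b = \<zero>"
    then have "r \<otimes> a = \<zero>" using w by simp
    then have "r = \<zero>" using w e integral by blast
    then show False using w M.zero_closed by blast
  qed
  then obtain j q v where q: "q \<in> carrier R - M" "v \<in> carrier R - M" "q \<otimes> b = v \<otimes> t [^] Suc j"
    using uniformizer_at_factor_mem[OF M t w(2)] by blast
  have C: "t \<in> carrier R" "b \<in> carrier R" "q \<in> carrier R" "v \<in> carrier R" "r \<in> carrier R"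
    "s \<in> carrier R" "u \<in> carrier R" "c \<in> carrier R" "a \<in> carrier R"
    using tM w q e M.Icarr by auto
  \<comment> \<open>Everything on the right except \<open>t [^] Suc k\<close>, of which one factor
    \<open>t\<close> survives the cancellation.\<close>
  define d where "d = s \<otimes> c \<otimes> v [^] Suc k \<otimes> (t [^] j) [^] Suc k"
  have d: "d \<in> carrier R" using C by (simp add: d_def)
  have "(q [^] Suc k \<otimes> r \<otimes> u) \<otimes> t [^] k = q [^] Suc k \<otimes> r \<otimes> (s \<otimes> a)"
    using C e(5) by (simp add: m_assoc)
  also have "\<dots> = q [^] Suc k \<otimes> s \<otimes> (r \<otimes> a)"
    using C nat_pow_closed[of q "Suc k"] by (simp add: m_ac del: nat_pow_Suc)
  also have "\<dots> = s \<otimes> c \<otimes> (q [^] Suc k \<otimes> b [^] Suc k)"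
    unfolding w(4) using C nat_pow_closed[of q "Suc k"] nat_pow_closed[of b "Suc k"]
    by (simp add: m_ac del: nat_pow_Suc)
  also have "q [^] Suc k \<otimes> b [^] Suc k = (v \<otimes> t [^] Suc j) [^] Suc k"
    unfolding q(3)[symmetric] using C by (intro nat_pow_distrib[symmetric])
  also have "\<dots> = v [^] Suc k \<otimes> (t [^] j) [^] Suc k \<otimes> t [^] Suc k"
    using C by (simp add: nat_pow_distrib m_ac)
  also have "s \<otimes> c \<otimes> \<dots> = (d \<otimes> t) \<otimes> t [^] k"
    unfolding d_def using C by (simp add: m_ac)
  finally have "(q [^] Suc k \<otimes> r \<otimes> u) \<otimes> t [^] k = (d \<otimes> t) \<otimes> t [^] k" .
  moreover have "t [^] k \<noteq> \<zero>"
    using tM(2) C(1) by (induction k) (auto simp: integral_iff)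
  ultimately have "q [^] Suc k \<otimes> r \<otimes> u = d \<otimes> t"
    using C d m_rcancel[of "t [^] k"] by simp
  then have "q [^] Suc k \<otimes> r \<otimes> u \<in> M"
    using d tM M.I_l_closed by simp
  then have "q [^] Suc k \<in> M"
    using M.I_prime w q e C by (metis DiffD2 m_closed nat_pow_closed)
  then show False
    using M.pow_mem q by blast
qed

end

section \<open>Almost Dedekind domains\<close>

locale almost_dedekind = domain +
  assumes almost_dedekind_domain: "almost_dedekind_domain R"
begin

lemma uniformizer_at_maximalideal:
  assumes "maximalideal M R"
  obtains t where "uniformizer_at R M t"
  using uniformizer_at_exists assms almost_dedekind_domain
  unfolding almost_dedekind_domain_def Max_spec_def by blast

lemma order_bounded_locally:
  assumes "finite A" "maximalideal M R" "A \<subseteq> M" and a: "a \<in> carrier R" "a \<noteq> \<zero>"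
  obtains B N k where "finite B" "A \<subseteq> B" "maximalideal N R" "B \<subseteq> N"
    "\<And>N. maximalideal N R \<Longrightarrow> B \<subseteq> N \<Longrightarrow> \<not> order_ge R N k a"
proof (rule ccontr)
  assume contra: "\<not> thesis"
  note witness = that
  have unb: "\<exists>N. maximalideal N R \<and> B \<subseteq> N \<and> order_ge R N k a"
    if "finite B" "A \<subseteq> B" "maximalideal N R" "B \<subseteq> N" for B N k
    using witness[OF that] contra by blast
  let ?P = "\<lambda>(n::nat) B. finite B \<and> A \<subseteq> B \<and> (\<exists>N. maximalideal N R \<and> B \<subseteq> N)"
  \<comment> \<open>Step \<open>n\<close> shrinks \<open>V(B)\<close> to a nonempty
    \<open>V(C)\<close> on which the order of \<open>a\<close> is at least \<open>n\<close>.\<close>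
  let ?Q = "\<lambda>n B C. B \<subseteq> C \<and> (\<forall>N. maximalideal N R \<longrightarrow> C \<subseteq> N \<longrightarrow> order_ge R N n a)"
  have "\<exists>f. \<forall>n. ?P n (f n) \<and> ?Q n (f n) (f (Suc n))"
  proof (rule dependent_nat_choice)
    show "\<exists>B. ?P 0 B" using assms by blast
    fix B n assume B: "?P n B"
    then obtain N where N: "maximalideal N R" "B \<subseteq> N" "order_ge R N n a"
      using unb by blast
    have "finite B" "A \<subseteq> B" using B by simp_all
    obtain C where "finite C" "B \<subseteq> C" "C \<subseteq> N"
      "\<And>N. maximalideal N R \<Longrightarrow> C \<subseteq> N \<Longrightarrow> order_ge R N n a"
      using order_ge_locally[OF N(1,2) \<open>finite B\<close> N(3)] by blast
    then have "?P (Suc n) C \<and> ?Q n B C" using N(1) \<open>A \<subseteq> B\<close> by blast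
    then show "\<exists>C. ?P (Suc n) C \<and> ?Q n B C" by (rule exI)
  qed
  then obtain F where F: "\<And>n. ?P n (F n)" "\<And>n. ?Q n (F n) (F (Suc n))" by blast
  have Fc: "F n \<subseteq> carrier R" and one: "\<one> \<notin> Idl (F n)" for n
  proof -
    obtain N where N: "maximalideal N R" "F n \<subseteq> N" using F(1) by blast
    interpret N: maximalideal N R by fact
    show "F n \<subseteq> carrier R" using N N.Icarr by blast
    have "Idl (F n) \<subseteq> N" using genideal_minimal N N.is_ideal by blast
    then show "\<one> \<notin> Idl (F n)" using N.one_imp_carrier N.I_notcarr by blast
  qed
  have mono: "Idl (F n) \<subseteq> Idl (F m)" if "n \<le> m" for n m
  proof -
    have "F n \<subseteq> F m" using lift_Suc_mono_le[of F n m] F(2) that by blast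
    then show ?thesis
      using genideal_minimal[OF genideal_ideal[OF Fc[of m]]] genideal_self[OF Fc[of m]] by blast
  qed
  have "Idl (F n) \<subseteq> Idl (F m) \<or> Idl (F m) \<subseteq> Idl (F n)" for n m
    using mono nat_le_linear by blast
  then have "subset.chain {I. ideal I R} (range (\<lambda>n. Idl (F n)))"
    using genideal_ideal[OF Fc] unfolding pred_on.chain_def by blast
  \<comment> \<open>Compactness enters here: an increasing union of ideals without
    \<open>\<one>\<close> is an ideal without \<open>\<one>\<close>, so one maximal ideal
    \<open>N\<close> contains all \<open>F n\<close>.\<close>
  then have "ideal (\<Union>n. Idl (F n)) R"
    using chain_Union_is_ideal by fastforce
  then obtain N where N: "maximalideal N R" "(\<Union>n. Idl (F n)) \<subseteq> N"
    using ideal_subset_maximalideal one by (metis UN_E)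
  have "F n \<subseteq> N" for n
    using N(2) genideal_self[OF Fc[of n]] by blast
  then have ord: "order_ge R N n a" for n
    using F(2) N(1) by blast
  obtain t where t: "uniformizer_at R N t"
    using uniformizer_at_maximalideal N(1) by blast
  then obtain k :: nat and s u where "s \<in> carrier R - N" "u \<in> carrier R - N" "s \<otimes> a = u \<otimes> t [^] k"
    using a unfolding uniformizer_at_def by blast
  then have "Suc k \<le> k"
    using order_ge_le[OF N(1) t _ _ a _ ord] by blast
  then show False by simp
qed

text \<open>The resulting \<open>N\<close> may differ from \<open>M\<close>: it is chosen in a
  smaller basic set, at a point where the order of a fixed \<open>a\<close> is maximal.\<close>

lemma fg_radical_ideal_exists:
  assumes "finite A" "maximalideal M R" "A \<subseteq> M"
  obtains N I where "maximalideal N R" "A \<subseteq> I" "I \<subseteq> N" "fg_ideal I R" "radical_ideal I R" "I \<noteq> {\<zero>}"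
proof -
  interpret M: maximalideal M R by fact
  obtain a where a: "a \<in> M" "a \<noteq> \<zero>"
    using uniformizer_at_maximalideal[OF assms(2)] unfolding uniformizer_at_def by blast
  have ac: "a \<in> carrier R" using a M.Icarr by blast
  have "finite (insert a A)" "insert a A \<subseteq> M" using assms a by auto
  then obtain B N0 b where B: "finite B" "insert a A \<subseteq> B" "maximalideal N0 R" "B \<subseteq> N0"
    and bnd: "\<And>N. maximalideal N R \<Longrightarrow> B \<subseteq> N \<Longrightarrow> \<not> order_ge R N b a"
    using order_bounded_locally[OF _ assms(2) _ ac a(2)] by metis
  define P where "P k \<longleftrightarrow> (\<exists>N. maximalideal N R \<and> B \<subseteq> N \<and> order_ge R N k a)" for k
  have mem: "order_ge R N 1 a" if N: "maximalideal N R" "B \<subseteq> N" for N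
  proof -
    interpret N: maximalideal N R by fact
    have "\<one> \<otimes> a = \<one> \<otimes> a [^] (1::nat)" using ac by simp
    moreover have "\<one> \<in> carrier R - N" using N.one_imp_carrier N.I_notcarr by blast
    moreover have "a \<in> N" using N B by blast
    ultimately show ?thesis unfolding order_ge_def by blast
  qed
  have P1: "P 1" unfolding P_def using mem B by blast
  have Pb: "k \<le> b" if "P k" for k
    using that bnd order_ge_mono unfolding P_def by (metis nat_le_linear)
  define k where "k = (GREATEST k. P k)"
  have Pk: "P k" and k_max: "\<And>j. P j \<Longrightarrow> j \<le> k"
    unfolding k_def using GreatestI_nat[of P, OF P1 Pb] Greatest_le_nat[of P, OF _ Pb] by auto
  have "1 \<le> k" using k_max P1 by blast
  obtain N where N: "maximalideal N R" "B \<subseteq> N" "order_ge R N k a"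
    using Pk unfolding P_def by blast
  interpret N: maximalideal N R by fact
  obtain t where t: "uniformizer_at R N t"
    using uniformizer_at_maximalideal N(1) by blast
  then have tN: "t \<in> N" "t \<noteq> \<zero>" unfolding uniformizer_at_def by auto
  have tc: "t \<in> carrier R" using tN N.Icarr by blast
  obtain k' :: nat and s u where su: "s \<in> carrier R - N" "u \<in> carrier R - N" "s \<otimes> a = u \<otimes> t [^] k'"
    using t a ac unfolding uniformizer_at_def by blast
  have "k \<le> k'" using order_ge_le[OF N(1) t su(1,2) ac a(2) su(3) N(3)] .
  \<comment> \<open>The equation \<open>s a = u t^k'\<close> itself witnesses \<open>P k'\<close>,
    so maximality of \<open>k\<close> applies.\<close>
  moreover have "k' \<le> k"
    using k_max N(1,2) su tN unfolding P_def order_ge_def by blast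
  ultimately have "k' = k" by simp
  obtain g h where g: "g \<in> N" "h \<in> carrier R" "s \<otimes> h \<oplus> g = \<one>"
    using maximalideal_comaximal[OF N(1)] su(1) by blast
  \<comment> \<open>\<open>B\<close> keeps the bound \<open>k\<close> on the order of
    \<open>a\<close>, \<open>g\<close> keeps \<open>s\<close> outside, and \<open>t\<close> will
    generate every such maximal ideal locally.\<close>
  define G where "G = insert g (insert t B)"
  define I where "I = Idl G"
  have G: "G \<subseteq> N" "finite G" using g tN N B unfolding G_def by auto
  then have Gc: "G \<subseteq> carrier R" using N.Icarr by blast
  have I: "ideal I R" "G \<subseteq> I" "I \<subseteq> N"
    unfolding I_def using genideal_ideal[OF Gc] genideal_self[OF Gc]
      genideal_minimal[OF N.is_ideal G(1)] by auto
  interpret I: ideal I R by (rule I)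
  have tI: "t \<in> I" using I G_def by blast
  have "fg_ideal I R" unfolding fg_ideal_def I_def using Gc G by blast
  moreover have "I \<noteq> {\<zero>}" using tI tN by blast
  moreover have "A \<subseteq> I" using B I unfolding G_def by blast
  moreover have "radical_ideal I R"
    unfolding radical_ideal_def
  proof (intro conjI equalityI subsetI)
    show "ideal I R" by (rule I)
    show "x \<in> radical R I" if "x \<in> I" for x
    proof -
      have "x [^] (1::nat) \<in> I" using that I.Icarr by simp
      then show ?thesis unfolding radical_def using that I.Icarr by blast
    qed
    fix x assume "x \<in> radical R I"
    then obtain e :: nat where x: "x \<in> carrier R" "x [^] e \<in> I" unfolding radical_def by blast
    show "x \<in> I"
    \<comment> \<open>Zero has no factorization through a uniformizer and is treated apart.\<close>
    proof (cases "x = \<zero>")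
      case True
      then show ?thesis by simp
    next
      case False
      show ?thesis
      proof (rule mem_ideal_if_locally[OF I(1) x(1)])
        fix Q assume Q: "maximalideal Q R" "I \<subseteq> Q"
        interpret Q: primeideal Q R using maximalideal_prime[OF Q(1)] .
        have GQ: "G \<subseteq> Q" using I Q by blast
        then have "s \<notin> Q" using comaximal_not_mem[OF Q(1) _ g(2,3)] unfolding G_def by blast
        obtain q where q: "uniformizer_at R Q q" using uniformizer_at_maximalideal Q(1) by blast
        then have qQ: "q \<in> Q" unfolding uniformizer_at_def by blast
        then have qc: "q \<in> carrier R" using Q.Icarr by blast
        have "t \<in> Q" using tI Q(2) by blast
        obtain j r v where rv: "r \<in> carrier R - Q" "v \<in> carrier R - Q" "r \<otimes> t = v \<otimes> q [^] Suc j"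
          using uniformizer_at_factor_mem[OF Q(1) q \<open>t \<in> Q\<close> tN(2)] by blast
        have C: "r \<in> carrier R" "v \<in> carrier R" "s \<in> carrier R" "u \<in> carrier R"
          using rv su by auto
        \<comment> \<open>If \<open>t\<close> has order \<open>j + 1\<close> at \<open>Q\<close>,
          then \<open>a\<close> has order at least \<open>(j + 1) k\<close> there. Maximality of
          \<open>k\<close>, together with \<open>1 \<le> k\<close>, forces
          \<open>j = 0\<close>.\<close>
        have "(r [^] k \<otimes> s) \<otimes> a = r [^] k \<otimes> (u \<otimes> t [^] k)"
          using C ac su(3) \<open>k' = k\<close> by (simp add: m_assoc)
        also have "\<dots> = u \<otimes> (r \<otimes> t) [^] k"
          using C tc by (simp add: nat_pow_distrib m_ac)
        also have "\<dots> = (u \<otimes> v [^] k) \<otimes> q [^] (Suc j * k)"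
          unfolding rv(3) using C qc
          by (simp add: nat_pow_distrib nat_pow_pow nat_pow_mult add.commute m_assoc)
        finally have "(r [^] k \<otimes> s) \<otimes> a = (u \<otimes> v [^] k) \<otimes> q [^] (Suc j * k)" .
        moreover have "r [^] k \<otimes> s \<in> carrier R - Q"
          using C rv \<open>s \<notin> Q\<close> Q.I_prime Q.pow_mem by (metis DiffD2 DiffI m_closed nat_pow_closed)
        moreover have "u \<otimes> v [^] k \<in> carrier R" using C by simp
        ultimately have "order_ge R Q (Suc j * k) a"
          unfolding order_ge_def using qQ by blast
        then have "Suc j * k \<le> k"
          using k_max Q(1) GQ unfolding P_def G_def by blast
        then have "j = 0" using \<open>1 \<le> k\<close> by simp
        then have vq: "v \<otimes> q = r \<otimes> t" using rv qc by simp
        have "x \<in> Q" using Q.pow_mem x Q(2) by blast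
        obtain i y z where yz: "y \<in> carrier R - Q" "z \<in> carrier R - Q"
          "y \<otimes> x = z \<otimes> q [^] Suc i"
          using uniformizer_at_factor_mem[OF Q(1) q \<open>x \<in> Q\<close> False] by blast
        have C': "y \<in> carrier R" "z \<in> carrier R" using yz by auto
        \<comment> \<open>One factor \<open>q\<close> of \<open>x\<close>, multiplied by
          \<open>v\<close>, is traded for \<open>r t\<close>, so a multiple of \<open>x\<close> by
          an element outside \<open>Q\<close> is a multiple of \<open>t\<close> and lies in
          \<open>I\<close>.\<close>
        have "(v \<otimes> y) \<otimes> x = v \<otimes> (z \<otimes> q [^] Suc i)"
          using C C' x yz(3) by (simp add: m_assoc)
        also have "\<dots> = (z \<otimes> q [^] i) \<otimes> (v \<otimes> q)"
          using C C' qc by (simp add: m_ac)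
        also have "\<dots> = (z \<otimes> q [^] i \<otimes> r) \<otimes> t"
          unfolding vq using C C' qc tc by (simp add: m_assoc)
        finally have "(v \<otimes> y) \<otimes> x \<in> I"
          using tI C C' qc I.I_l_closed by simp
        moreover have "v \<otimes> y \<in> carrier R - Q"
          using rv yz Q.I_prime by blast
        ultimately show "\<exists>r\<in>carrier R - Q. r \<otimes> x \<in> I" by blast
      qed
    qed
  qed
  ultimately show thesis using that N(1) I(3) by blast
qed

end

theorem theorem5p6:
  fixes D :: "('a, 'b) ring_scheme"
  assumes "almost_dedekind_domain D"
  shows "constructible_Max D closure_of (Max_spec D - Crit D) = topspace (constructible_Max D)"
proof -
  interpret almost_dedekind D
    using assms by (simp add: almost_dedekind_def almost_dedekind_axioms_def almost_dedekind_domain_def)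
  have "\<exists>N\<in>Max_spec D - Crit D. N \<in> U" if U: "openin (constructible_Max D) U" "M \<in> U" for U M
  proof -
    have "M \<in> Max_spec D"
      using openin_subset[OF U(1)] U(2) by auto
    then have M: "maximalideal M D"
      by (simp add: Max_spec_def)
    obtain A where A: "finite A" "A \<subseteq> M" "\<And>N. maximalideal N D \<Longrightarrow> A \<subseteq> N \<Longrightarrow> N \<in> U"
      using constructible_Max_basis[OF U] by blast
    obtain N I where N: "maximalideal N D" "A \<subseteq> I" "I \<subseteq> N"
      and I: "fg_ideal I D" "radical_ideal I D" "I \<noteq> {\<zero>\<^bsub>D\<^esub>}"
      using fg_radical_ideal_exists[OF A(1) M A(2)] by blast
    \<comment> \<open>\<open>I\<close> itself witnesses that \<open>N\<close> is not critical, while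
      \<open>A \<subseteq> I \<subseteq> N\<close> places \<open>N\<close> in
      \<open>U\<close>.\<close>
    have "N \<in> Max_spec D - Crit D"
      using N I unfolding Max_spec_def Crit_def by blast
    moreover have "N \<in> U" using A(3) N by blast
    ultimately show ?thesis by blast
  qed
  then show ?thesis
    unfolding closure_of_def by blast
qed

end
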